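(* Let $X=\mathbb{R}^n$ with the Euclidean norm and let $F\subseteq X$ be a nonempty closed convex set with $0\in\mathrm{int}\,F$. Let $\Omega_i$, $i=1,\ldots,m$, and $\Omega$ be nonempty closed bounded convex subsets of $\mathbb{R}^n$, let $\mathcal{T}(x)=\max\{\mathcal{T}^F_{\Omega_i}(x): i=1,\ldots,m\}$, and consider the problem $$(P)\qquad\text{minimize } \mathcal{T}(x)\ \text{ subject to } x\in\Omega.$$ Fix $x_1\in\Omega$ and, for a sequence of real numbers $\{\alpha_k\}$, define the sequence of iterates by $$x_{k+1}=\mathcal{P}(x_k-\alpha_kx_k^*;\Omega)\quad\text{for all } k\in\mathbb{N},$$ where $$x_k^*\in\begin{cases}\{0\} & \text{if } x_k\in\Omega_i-F_\infty,\\ [-\partial\rho_F(\omega_k-x_k)]\cap N(\omega_k;\Omega_i) & \text{if } x_k\notin\Omega_i-F_\infty,\end{cases}$$ for some $i\in I(x_k)$, with $\omega_k\in\Omega_i$ in the second case. Let $V_k=\min\{\mathcal{T}(x_j): j=1,\ldots,k\}$. If $\sum_{i=1}^\infty\alpha_i=\infty$ and $\sum_{i=1}^\infty\alpha_i^2<\infty$, then the sequence $\{x_k\}$ converges to an optimal solution of (P) and $V_k$ converges to the optimal value $\overline V$ of (P). Moreover, $$V_k-\overline V\le\frac{d(x_1;S)^2+L^2\sum_{i=1}^k\alpha_i^2}{2\sum_{i=1}^k\alpha_i},$$ where $0\le L<\infty$ is a Lipschitz constant of the function $\mathcal{T}$ and $S$ is the solution set of (P).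
   Context: For $t\ge 0$, $tF=\{tf: f\in F\}$. For nonempty $Q\subseteq X$, the minimal time function is $\mathcal{T}^F_Q(x)=\inf\{t\ge 0: (x+tF)\cap Q\ne\emptyset\}$, and the Minkowski function is $\rho_F(x)=\inf\{t\ge 0: x\in tF\}$. The asymptotic cone of $F$ is $F_\infty=\{d\in X: x+td\in F \text{ for all } t>0\}$, where $x\in F$ is any point (the set does not depend on the choice of $x\in F$), and $\Omega_i-F_\infty=\{\omega-d: \omega\in\Omega_i,\ d\in F_\infty\}$. $I(u)=\{i\in\{1,\ldots,m\}: \mathcal{T}(u)=\mathcal{T}^F_{\Omega_i}(u)\}$. $\mathcal{P}(\cdot;\Omega)$ is the Euclidean projection onto $\Omega$, and $d(x;S)=\inf\{\|x-s\|: s\in S\}$. For convex $\varphi$ and $\bar x$ with $\varphi(\bar x)<\infty$, $\partial\varphi(\bar x)=\{x^*: \langle x^*,x-\bar x\rangle\le\varphi(x)-\varphi(\bar x)\text{ for all }x\in X\}$; for a convex set $A$ and $\bar x\in A$, $N(\bar x;A)=\{x^*: \langle x^*,x-\bar x\rangle\le 0\text{ for all }x\in A\}$.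
   Formalization: The step sizes α_k are assumed nonnegative (for arbitrary real α_k the bound fails, e.g. T(x)=|x|, Ω=[-1,1], x_1=1/2, α_1=-1), and the bound is stated for those k with α_1+…+α_k>0, where its right side is defined. *)

theory Defs
  imports "HOL-Analysis.Analysis"
begin

text \<open>The infima below are taken in \<^typ>\<open>real\<close>. The sets involved are bounded below by 0, and they
  are nonempty whenever \<open>0 \<in> interior F\<close> (lemmas \<open>min_time_feasible\<close> and
  \<open>minkowski_fun_feasible\<close>), so both functions are then real-valued and the infima are the intended
  ones.\<close>

definition min_time :: "'a::real_normed_vector set \<Rightarrow> 'a set \<Rightarrow> 'a \<Rightarrow> real" where
  "min_time F Q x = Inf {t. t \<ge> 0 \<and> (+) x ` (*\<^sub>R) t ` F \<inter> Q \<noteq> {}}"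

definition minkowski_fun :: "'a::real_normed_vector set \<Rightarrow> 'a \<Rightarrow> real" where
  "minkowski_fun F x = Inf {t. t \<ge> 0 \<and> x \<in> (*\<^sub>R) t ` F}"

lemma minkowski_fun_feasible:
  fixes F :: "'a::real_normed_vector set"
  assumes "0 \<in> interior F"
  shows "{t. t \<ge> 0 \<and> x \<in> (*\<^sub>R) t ` F} \<noteq> {}"
proof -
  obtain e where e: "e > 0" "cball 0 e \<subseteq> F"
    using assms mem_interior_cball by blast
  define t where "t = (norm x + 1) / e"
  have t: "t > 0"
    using e(1) unfolding t_def by (intro divide_pos_pos add_nonneg_pos) auto
  have "norm (inverse t *\<^sub>R x) = norm x * e / (norm x + 1)"
    using e(1) t by (simp add: t_def abs_if divide_simps)
  also have "\<dots> \<le> e"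
    using e(1) by (subst pos_divide_le_eq) (auto simp: add_pos_nonneg algebra_simps)
  finally have "inverse t *\<^sub>R x \<in> F"
    using e(2) by auto
  moreover have "x = t *\<^sub>R (inverse t *\<^sub>R x)"
    using t by simp
  ultimately have "x \<in> (*\<^sub>R) t ` F"
    by blast
  then show ?thesis
    using t by (auto intro: exI[of _ t])
qed

lemma min_time_feasible:
  fixes F Q :: "'a::real_normed_vector set"
  assumes "0 \<in> interior F" and "Q \<noteq> {}"
  shows "{t. t \<ge> 0 \<and> (+) x ` (*\<^sub>R) t ` F \<inter> Q \<noteq> {}} \<noteq> {}"
proof -
  obtain q where q: "q \<in> Q"
    using assms(2) by blast
  obtain t where t: "t \<ge> 0" "q - x \<in> (*\<^sub>R) t ` F"
    using minkowski_fun_feasible[OF assms(1), of "q - x"] by blast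
  have "x + (q - x) \<in> (+) x ` (*\<^sub>R) t ` F"
    using t(2) by (rule imageI)
  then show ?thesis
    using q t(1) by auto
qed

text \<open>The base point \<open>x\<close> is universally quantified; for closed convex \<open>F\<close> any single base point
  gives the same cone (lemma \<open>asymptotic_cone_base_point\<close>).\<close>

definition asymptotic_cone :: "'a::real_normed_vector set \<Rightarrow> 'a set" where
  "asymptotic_cone F = {d. \<forall>x\<in>F. \<forall>t>0. x + t *\<^sub>R d \<in> F}"

lemma asymptotic_cone_base_point:
  fixes F :: "'a::real_normed_vector set"
  assumes "closed F" and "convex F" and x: "x \<in> F"
  shows "asymptotic_cone F = {d. \<forall>t>0. x + t *\<^sub>R d \<in> F}"
proof -
  have "y + t *\<^sub>R d \<in> F" if d: "\<forall>t>0. x + t *\<^sub>R d \<in> F" and y: "y \<in> F" and t: "t > 0" for d y t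
  proof -
    define u where "u = (\<lambda>n. inverse (real (Suc n)))"
    have u: "0 < u n" "u n \<le> 1" for n
      by (auto simp: u_def divide_simps)
    have mem: "(1 - u n) *\<^sub>R y + u n *\<^sub>R (x + (t / u n) *\<^sub>R d) \<in> F" for n
      using convexD[OF assms(2) y, of "x + (t / u n) *\<^sub>R d" "1 - u n" "u n"] d t u[of n] by simp
    have eq: "(1 - u n) *\<^sub>R y + u n *\<^sub>R (x + (t / u n) *\<^sub>R d) = y + t *\<^sub>R d + u n *\<^sub>R (x - y)" for n
      using u(1)[of n] by (simp add: algebra_simps)
    have "u \<longlonglongrightarrow> 0"
      unfolding u_def by (rule LIMSEQ_inverse_real_of_nat)
    then have "(\<lambda>n. y + t *\<^sub>R d + u n *\<^sub>R (x - y)) \<longlonglongrightarrow> y + t *\<^sub>R d + 0 *\<^sub>R (x - y)"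
      by (intro tendsto_intros)
    then show ?thesis
      using closed_sequentially[OF assms(1) mem[unfolded eq]] by simp
  qed
  then show ?thesis
    using x by (auto simp: asymptotic_cone_def)
qed

definition subdifferential :: "('a::real_inner \<Rightarrow> real) \<Rightarrow> 'a \<Rightarrow> 'a set" where
  "subdifferential \<phi> u = {v. \<forall>x. v \<bullet> (x - u) \<le> \<phi> x - \<phi> u}"

definition normal_cone :: "'a::real_inner set \<Rightarrow> 'a \<Rightarrow> 'a set" where
  "normal_cone A u = {v. \<forall>x\<in>A. v \<bullet> (x - u) \<le> 0}"

definition max_time :: "'a::real_normed_vector set \<Rightarrow> (nat \<Rightarrow> 'a set) \<Rightarrow> nat \<Rightarrow> 'a \<Rightarrow> real" where
  "max_time F \<Omega>s m x = (MAX i\<in>{1..m}. min_time F (\<Omega>s i) x)"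

definition active :: "'a::real_normed_vector set \<Rightarrow> (nat \<Rightarrow> 'a set) \<Rightarrow> nat \<Rightarrow> 'a \<Rightarrow> nat set" where
  "active F \<Omega>s m u = {i\<in>{1..m}. max_time F \<Omega>s m u = min_time F (\<Omega>s i) u}"

definition solutions :: "('a \<Rightarrow> real) \<Rightarrow> 'a set \<Rightarrow> 'a set" where
  "solutions f \<Omega> = {x\<in>\<Omega>. \<forall>y\<in>\<Omega>. f x \<le> f y}"

end

theory Submission
  imports Defs
begin

text \<open>At every iterate the direction is a subgradient of the maximal time function. In the second
  case, the normal cone condition and the subgradient inequality for the Minkowski function at
  \<open>\<omega> - x\<close> together force \<open>\<omega>\<close> to be a generalized projection of \<open>x\<close>; in the first case the time
  function vanishes at \<open>x\<close> and is therefore minimal there. The scheme is thus a projected subgradient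
  method for a Lipschitz function on a compact convex set. Nonexpansiveness of the projection shows
  that the squared distance to any solution decreases up to the summable error \<open>L\<^sup>2 \<alpha>\<^sup>2\<close>. Since the
  step sizes have infinite sum, some subsequence is minimizing, it clusters at a solution, and this
  quasi-monotonicity forces the whole sequence to converge to that solution.\<close>

section \<open>The minimal time function\<close>

lemma min_time_nonneg:
  fixes F Q :: "'a::real_normed_vector set"
  assumes "0 \<in> interior F" "Q \<noteq> {}"
  shows "0 \<le> min_time F Q x"
  unfolding min_time_def using min_time_feasible[OF assms, of x] by (intro cInf_greatest) auto

lemma min_time_le:
  assumes "0 \<le> t" "f \<in> F" "x + t *\<^sub>R f \<in> Q"
  shows "min_time F Q x \<le> t"
  unfolding min_time_def
proof (rule cInf_lower)
  show "t \<in> {t. 0 \<le> t \<and> (+) x ` (*\<^sub>R) t ` F \<inter> Q \<noteq> {}}"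
    using assms by blast
  show "bdd_below {t. 0 \<le> t \<and> (+) x ` (*\<^sub>R) t ` F \<inter> Q \<noteq> {}}"
    by (rule bdd_belowI[of _ 0]) auto
qed

lemma min_time_greatest:
  fixes F Q :: "'a::real_normed_vector set"
  assumes "0 \<in> interior F" "Q \<noteq> {}"
    and "\<And>t f. 0 \<le> t \<Longrightarrow> f \<in> F \<Longrightarrow> x + t *\<^sub>R f \<in> Q \<Longrightarrow> c \<le> t"
  shows "c \<le> min_time F Q x"
  unfolding min_time_def
proof (rule cInf_greatest)
  show "{t. 0 \<le> t \<and> (+) x ` (*\<^sub>R) t ` F \<inter> Q \<noteq> {}} \<noteq> {}"
    by (rule min_time_feasible[OF assms(1,2)])
qed (use assms(3) in auto)

lemma minkowski_fun_le:
  assumes "0 \<le> t" "f \<in> F"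
  shows "minkowski_fun F (t *\<^sub>R f) \<le> t"
  unfolding minkowski_fun_def
proof (rule cInf_lower)
  show "t \<in> {s. 0 \<le> s \<and> t *\<^sub>R f \<in> (*\<^sub>R) s ` F}"
    using assms by blast
  show "bdd_below {s. 0 \<le> s \<and> t *\<^sub>R f \<in> (*\<^sub>R) s ` F}"
    by (rule bdd_belowI[of _ 0]) auto
qed

lemma min_time_le_minkowski_fun:
  fixes F Q :: "'a::real_normed_vector set"
  assumes "0 \<in> interior F" "w \<in> Q"
  shows "min_time F Q x \<le> minkowski_fun F (w - x)"
  unfolding minkowski_fun_def
proof (rule cInf_greatest[OF minkowski_fun_feasible[OF assms(1)]])
  fix t assume "t \<in> {t. 0 \<le> t \<and> w - x \<in> (*\<^sub>R) t ` F}"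
  then obtain f where f: "0 \<le> t" "f \<in> F" "w - x = t *\<^sub>R f"
    by auto
  then have "x + t *\<^sub>R f = w"
    by (metis add_diff_cancel_left' diff_add_cancel add.commute)
  then show "min_time F Q x \<le> t"
    using f(1,2) assms(2) by (intro min_time_le[of t f]) auto
qed

text \<open>From \<open>y\<close> one can first travel to \<open>x\<close>, which the ball inside
  \<open>F\<close> allows in time \<open>norm (x - y) / r\<close>, and then follow any route from
  \<open>x\<close> to \<open>Q\<close>; convexity of \<open>F\<close> fuses the two moves into
  one.\<close>

lemma min_time_lipschitz:
  fixes F Q :: "'a::real_normed_vector set"
  assumes "convex F" "cball 0 r \<subseteq> F" "0 < r" "Q \<noteq> {}"
  shows "(1 / r)-lipschitz_on UNIV (min_time F Q)"
proof -
  have int: "0 \<in> interior F"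
    using assms(2,3) mem_interior_cball by blast
  have le: "min_time F Q y - norm (x - y) / r \<le> min_time F Q x" for x y
  proof (rule min_time_greatest[OF int assms(4)])
    fix t f assume t: "0 \<le> t" "f \<in> F" "x + t *\<^sub>R f \<in> Q"
    show "min_time F Q y - norm (x - y) / r \<le> t"
    \<comment> \<open>The split keeps \<open>u\<close> positive, as \<open>h\<close> is normalized
      by it.\<close>
    proof (cases "x = y")
      case True
      then show ?thesis
        using min_time_le[OF t] by simp
    next
      case False
      define u where "u = norm (x - y) / r"
      have u: "0 < u"
        using False assms(3) by (simp add: u_def)
      define h where "h = inverse u *\<^sub>R (x - y)"
      have "norm h = r"
        using False assms(3) by (simp add: h_def u_def)
      then have h: "h \<in> F"
        using assms(2) by auto
      \<comment> \<open>The weights are the shares of the total time \<open>t + u\<close> spent on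
        the two moves.\<close>
      define f' where "f' = (t / (t + u)) *\<^sub>R f + (u / (t + u)) *\<^sub>R h"
      have "f' \<in> F"
        unfolding f'_def using t u h
        by (intro convexD[OF assms(1)]) (auto simp: add_divide_distrib[symmetric])
      moreover have "(t + u) *\<^sub>R f' = t *\<^sub>R f + (x - y)"
        using t(1) u by (simp add: f'_def h_def scaleR_add_right)
      then have "y + (t + u) *\<^sub>R f' \<in> Q"
        using t(3) by (simp add: algebra_simps)
      ultimately have "min_time F Q y \<le> t + u"
        using t(1) u by (intro min_time_le) auto
      then show ?thesis
        by (simp add: u_def)
    qed
  qed
  show ?thesis
  proof (rule lipschitz_onI)
    fix x y :: 'a
    show "dist (min_time F Q x) (min_time F Q y) \<le> 1 / r * dist x y"
      using le[of x y] le[of y x] by (simp add: dist_norm norm_minus_commute abs_le_iff)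
  qed (use assms(3) in auto)
qed

text \<open>Both dual conditions are tested on an arbitrary route from \<open>y\<close> into
  \<open>Q\<close>, which bounds its travel time from below.\<close>

lemma min_time_subgradient:
  fixes F Q :: "'a::real_inner set"
  assumes "0 \<in> interior F" "w \<in> Q"
    and sub: "- v \<in> subdifferential (minkowski_fun F) (w - x)" and nor: "v \<in> normal_cone Q w"
  shows "v \<in> subdifferential (min_time F Q) x"
proof -
  have "v \<bullet> (y - x) + minkowski_fun F (w - x) \<le> min_time F Q y" for y
  proof (rule min_time_greatest)
    fix t f assume t: "0 \<le> t" "f \<in> F" "y + t *\<^sub>R f \<in> Q"
    \<comment> \<open>Adding this to the normal cone inequality at the arrival point cancels both
      \<open>w\<close> and the displacement along \<open>f\<close>.\<close>
    have "- v \<bullet> (t *\<^sub>R f - (w - x)) \<le> minkowski_fun F (t *\<^sub>R f) - minkowski_fun F (w - x)"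
      using sub by (auto simp: subdifferential_def)
    moreover have "v \<bullet> (y + t *\<^sub>R f - w) \<le> 0"
      using nor t(3) by (auto simp: normal_cone_def)
    ultimately show "v \<bullet> (y - x) + minkowski_fun F (w - x) \<le> t"
      using minkowski_fun_le[OF t(1,2)] by (simp add: inner_simps)
  qed (use assms in auto)
  \<comment> \<open>The bound of \<open>min_time F Q x\<close> by
    \<open>minkowski_fun F (w - x)\<close> turns this into the subgradient inequality; at
    \<open>y = x\<close> the two bounds together say that \<open>w\<close> is a generalized
    projection.\<close>
  then have "v \<bullet> (y - x) \<le> min_time F Q y - min_time F Q x" for y
    using min_time_le_minkowski_fun[OF assms(1,2), of x] by (smt (verit))
  then show ?thesis
    by (simp add: subdifferential_def)
qed

text \<open>Since 0 lies in \<open>F\<close>, so does every positive multiple of \<open>d\<close>;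
  the displacement \<open>d\<close> can thus be made in arbitrarily short time.\<close>

lemma min_time_eq_0:
  fixes F Q :: "'a::real_normed_vector set"
  assumes "0 \<in> interior F" "w \<in> Q" "d \<in> asymptotic_cone F"
  shows "min_time F Q (w - d) = 0"
proof (rule antisym)
  have "0 \<in> F"
    using assms(1) interior_subset by blast
  then have *: "t *\<^sub>R d \<in> F" if "0 < t" for t
    using assms(3) that unfolding asymptotic_cone_def by fastforce
  show "min_time F Q (w - d) \<le> 0"
  proof (rule field_le_epsilon)
    fix e :: real assume "0 < e"
    \<comment> \<open>In time \<open>e\<close>, the velocity \<open>inverse e *\<^sub>R d\<close>
      covers exactly \<open>d\<close>.\<close>
    then show "min_time F Q (w - d) \<le> 0 + e"
      using *[of "inverse e"] assms(2) by (intro min_time_le[of _ "inverse e *\<^sub>R d"]) auto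
  qed
qed (use assms min_time_nonneg in blast)

section \<open>The maximal time function\<close>

lemma min_time_le_max_time:
  "i \<in> {1..m} \<Longrightarrow> min_time F (\<Omega>s i) x \<le> max_time F \<Omega>s m x"
  unfolding max_time_def by (intro Max_ge) auto

lemma max_time_attained:
  assumes "1 \<le> m"
  obtains i where "i \<in> {1..m}" "max_time F \<Omega>s m x = min_time F (\<Omega>s i) x"
proof -
  have "max_time F \<Omega>s m x \<in> (\<lambda>i. min_time F (\<Omega>s i) x) ` {1..m}"
    unfolding max_time_def using assms by (intro Max_in) auto
  then show ?thesis
    using that by blast
qed

text \<open>An index attaining the maximum at \<open>x\<close> competes in the maximum at
  \<open>y\<close>, so a common constant survives.\<close>

lemma max_time_lipschitz:
  fixes F :: "'a::real_normed_vector set"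
  assumes "1 \<le> m" "\<And>i. i \<in> {1..m} \<Longrightarrow> L-lipschitz_on UNIV (min_time F (\<Omega>s i))"
  shows "L-lipschitz_on UNIV (max_time F \<Omega>s m)"
proof (rule lipschitz_onI)
  have le: "max_time F \<Omega>s m x \<le> max_time F \<Omega>s m y + L * dist x y" for x y
  proof -
    obtain i where i: "i \<in> {1..m}" "max_time F \<Omega>s m x = min_time F (\<Omega>s i) x"
      using max_time_attained[OF assms(1)] .
    show ?thesis
      using lipschitz_onD[OF assms(2)[OF i(1)], of x y] min_time_le_max_time[OF i(1), of F \<Omega>s y] i(2)
      by (simp add: dist_real_def)
  qed
  show "dist (max_time F \<Omega>s m x) (max_time F \<Omega>s m y) \<le> L * dist x y" for x y
    using le[of x y] le[of y x] by (simp add: dist_real_def dist_commute abs_le_iff)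
  show "0 \<le> L"
    using assms(2)[of 1] assms(1) lipschitz_on_nonneg by auto
qed

text \<open>The maximum agrees with an active component at \<open>x\<close> and dominates it
  elsewhere.\<close>

lemma max_time_subgradient:
  assumes "i \<in> active F \<Omega>s m x" "v \<in> subdifferential (min_time F (\<Omega>s i)) x"
  shows "v \<in> subdifferential (max_time F \<Omega>s m) x"
  unfolding subdifferential_def
proof safe
  fix y
  have "v \<bullet> (y - x) \<le> min_time F (\<Omega>s i) y - min_time F (\<Omega>s i) x"
    using assms(2) by (simp add: subdifferential_def)
  also have "\<dots> \<le> max_time F \<Omega>s m y - max_time F \<Omega>s m x"
    using assms(1) min_time_le_max_time[of i m F \<Omega>s y] by (simp add: active_def)
  finally show "v \<bullet> (y - x) \<le> max_time F \<Omega>s m y - max_time F \<Omega>s m x" .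
qed

section \<open>The projected subgradient method\<close>

text \<open>A move from \<open>x\<close> by \<open>v\<close> itself must raise \<open>f\<close> by
  at least the square of \<open>norm v\<close>, yet can raise it by at most
  \<open>L * norm v\<close>.\<close>

lemma norm_subgradient_le_lipschitz:
  fixes f :: "'a::real_inner \<Rightarrow> real"
  assumes "L-lipschitz_on UNIV f" "v \<in> subdifferential f x"
  shows "norm v \<le> L"
proof (cases "v = 0")
  case True
  then show ?thesis
    using lipschitz_on_nonneg[OF assms(1)] by simp
next
  case False
  have "v \<bullet> (x + v - x) \<le> f (x + v) - f x"
    using assms(2) unfolding subdifferential_def by blast
  also have "\<dots> \<le> L * norm v"
    using lipschitz_onD[OF assms(1), of "x + v" x] by (simp add: dist_norm)
  finally have "norm v * norm v \<le> L * norm v"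
    by (simp add: dot_square_norm power2_eq_square)
  then show ?thesis
    using False by simp
qed

text \<open>Compactness yields a minimizer, and the solutions form the sublevel set at its
  value.\<close>

lemma solutions_closed_nonempty:
  fixes f :: "'a::heine_borel \<Rightarrow> real"
  assumes "continuous_on \<Omega> f" "compact \<Omega>" "\<Omega> \<noteq> {}"
  shows "closed (solutions f \<Omega>)" "solutions f \<Omega> \<noteq> {}"
proof -
  obtain s where s: "s \<in> \<Omega>" "\<forall>y\<in>\<Omega>. f s \<le> f y"
    using continuous_attains_inf[OF assms(2,3,1)] by blast
  then show "solutions f \<Omega> \<noteq> {}"
    by (auto simp: solutions_def)
  have "solutions f \<Omega> = {x \<in> \<Omega>. f x \<le> f s}"
    using s by (force simp: solutions_def)
  then show "closed (solutions f \<Omega>)"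
    using continuous_on_closed_Collect_le[OF assms(1) continuous_on_const compact_imp_closed[OF assms(2)]]
    by simp
qed

lemma solutions_eq_INF:
  assumes "s \<in> solutions f \<Omega>"
  shows "f s = (INF y\<in>\<Omega>. f y :: real)"
  using assms by (intro cInf_eq_minimum[symmetric]) (auto simp: solutions_def)

text \<open>The scheme is stated for an abstract objective and without conditions on infinite step
  sums, so the estimates here hold over finite ranges of steps.\<close>

locale projected_subgradient =
  fixes f :: "'a::euclidean_space \<Rightarrow> real" and \<Omega> :: "'a set" and L :: real
    and \<alpha> :: "nat \<Rightarrow> real" and x g :: "nat \<Rightarrow> 'a"
  assumes compact: "compact \<Omega>" and convex: "convex \<Omega>"
    and lipschitz: "L-lipschitz_on UNIV f"
    and start: "x 1 \<in> \<Omega>"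
    and iteration: "\<And>k. 1 \<le> k \<Longrightarrow> x (Suc k) = closest_point \<Omega> (x k - \<alpha> k *\<^sub>R g k)"
    and subgradient: "\<And>k. 1 \<le> k \<Longrightarrow> g k \<in> subdifferential f (x k)"
    and nonneg: "\<And>k. 1 \<le> k \<Longrightarrow> 0 \<le> \<alpha> k"
begin

lemma nonempty: "\<Omega> \<noteq> {}"
  using start by blast

lemma iterate_mem: "1 \<le> k \<Longrightarrow> x k \<in> \<Omega>"
proof (induction k rule: dec_induct)
  case (step n)
  then show ?case
    using closest_point_in_set[OF compact_imp_closed[OF compact] nonempty] iteration by simp
qed (rule start)

text \<open>Projection does not increase the distance to the feasible point \<open>s\<close>. In the
  expanded square, the subgradient inequality controls the cross term and
  \<open>norm (g k) \<le> L\<close> the quadratic one.\<close>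

lemma descent_step:
  assumes "1 \<le> k" "s \<in> \<Omega>"
  shows "(dist (x (Suc k)) s)\<^sup>2 + 2 * (\<alpha> k * (f (x k) - f s)) \<le> (dist (x k) s)\<^sup>2 + L\<^sup>2 * (\<alpha> k)\<^sup>2"
proof -
  have "dist (x (Suc k)) s \<le> dist (x k - \<alpha> k *\<^sub>R g k) s"
    using closest_point_lipschitz[OF convex compact_imp_closed[OF compact] nonempty, of _ s]
      closest_point_self[OF assms(2)] iteration[OF assms(1)] by metis
  then have "(dist (x (Suc k)) s)\<^sup>2 \<le> (dist (x k - \<alpha> k *\<^sub>R g k) s)\<^sup>2"
    by (intro power_mono) auto
  also have "\<dots> = (dist (x k) s)\<^sup>2 + 2 * (\<alpha> k * (g k \<bullet> (s - x k))) + (norm (g k))\<^sup>2 * (\<alpha> k)\<^sup>2"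
    unfolding dist_norm power2_norm_eq_inner
    by (simp add: inner_simps inner_commute power2_eq_square algebra_simps)
  also have "\<dots> \<le> (dist (x k) s)\<^sup>2 + 2 * (\<alpha> k * (f s - f (x k))) + L\<^sup>2 * (\<alpha> k)\<^sup>2"
  proof (intro add_mono mult_left_mono mult_right_mono power_mono)
    show "g k \<bullet> (s - x k) \<le> f s - f (x k)"
      using subgradient[OF assms(1)] by (simp add: subdifferential_def)
    show "norm (g k) \<le> L"
      using norm_subgradient_le_lipschitz[OF lipschitz subgradient[OF assms(1)]] .
  qed (use nonneg[OF assms(1)] in auto)
  finally show ?thesis
    by (simp add: algebra_simps)
qed

text \<open>The starting index is free because the convergence arguments also need tails.\<close>

lemma descent_sum:
  assumes "1 \<le> n" "n \<le> k" "s \<in> \<Omega>"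
  shows "(dist (x k) s)\<^sup>2 + 2 * (\<Sum>i=n..<k. \<alpha> i * (f (x i) - f s))
          \<le> (dist (x n) s)\<^sup>2 + L\<^sup>2 * (\<Sum>i=n..<k. (\<alpha> i)\<^sup>2)"
  using assms(2)
proof (induction k rule: dec_induct)
  case (step k)
  then show ?case
    using descent_step[of k s] assms by (simp add: algebra_simps)
qed simp

lemma weighted_gap_sum_le:
  assumes "1 \<le> n" "n \<le> k" "s \<in> \<Omega>"
  shows "2 * (\<Sum>i=n..<k. \<alpha> i * (f (x i) - f s)) \<le> (dist (x n) s)\<^sup>2 + L\<^sup>2 * (\<Sum>i=n..<k. (\<alpha> i)\<^sup>2)"
  using descent_sum[OF assms] zero_le_power2[of "dist (x k) s"] by linarith

text \<open>The best value is at most each \<open>f (x i)\<close>, so its gap times the total step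
  is at most the weighted sum of gaps.\<close>

lemma best_value_bound:
  assumes s: "s \<in> solutions f \<Omega>" and k: "1 \<le> k" and pos: "0 < (\<Sum>i=1..k. \<alpha> i)"
  shows "(MIN j\<in>{1..k}. f (x j)) - f s
    \<le> ((dist (x 1) s)\<^sup>2 + L\<^sup>2 * (\<Sum>i=1..k. (\<alpha> i)\<^sup>2)) / (2 * (\<Sum>i=1..k. \<alpha> i))"
proof -
  let ?V = "MIN j\<in>{1..k}. f (x j)"
  have "2 * ((\<Sum>i=1..k. \<alpha> i) * (?V - f s)) = 2 * (\<Sum>i=1..k. \<alpha> i * (?V - f s))"
    by (simp add: sum_distrib_right)
  also have "\<dots> \<le> 2 * (\<Sum>i=1..k. \<alpha> i * (f (x i) - f s))"
    using nonneg by (intro mult_left_mono sum_mono) auto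
  also have "\<dots> \<le> (dist (x 1) s)\<^sup>2 + L\<^sup>2 * (\<Sum>i=1..k. (\<alpha> i)\<^sup>2)"
    using weighted_gap_sum_le[of 1 "Suc k" s] s
    by (simp add: solutions_def atLeastLessThanSuc_atLeastAtMost)
  finally show ?thesis
    using pos by (subst pos_le_divide_eq) (auto simp: algebra_simps)
qed

lemma best_value_ge:
  assumes "s \<in> solutions f \<Omega>" "1 \<le> k"
  shows "f s \<le> (MIN j\<in>{1..k}. f (x j))"
  using assms iterate_mem by (subst Min_ge_iff) (auto simp: solutions_def)

end

section \<open>Convergence for divergent step sums with summable squares\<close>

locale convergent_projected_subgradient = projected_subgradient +
  assumes diverges: "filterlim (\<lambda>k. \<Sum>i=1..k. \<alpha> i) at_top sequentially"
    and square_summable: "summable (\<lambda>i. (\<alpha> i)\<^sup>2)"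
begin

lemma best_value_tendsto:
  assumes "s \<in> solutions f \<Omega>"
  shows "(\<lambda>k. MIN j\<in>{1..k}. f (x j)) \<longlonglongrightarrow> f s"
proof -
  let ?C = "(dist (x 1) s)\<^sup>2 + L\<^sup>2 * (\<Sum>i. (\<alpha> i)\<^sup>2)"
  have lim: "(\<lambda>k. ?C / (2 * (\<Sum>i=1..k. \<alpha> i))) \<longlonglongrightarrow> 0"
    by (intro tendsto_divide_0[OF tendsto_const] filterlim_at_top_imp_at_infinity
        filterlim_tendsto_pos_mult_at_top[OF tendsto_const _ diverges]) auto
  have "\<forall>\<^sub>F k in sequentially. norm ((MIN j\<in>{1..k}. f (x j)) - f s) \<le> ?C / (2 * (\<Sum>i=1..k. \<alpha> i))"
    using filterlim_at_top_dense[THEN iffD1, rule_format, OF diverges, of 0] eventually_ge_at_top[of 1]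
  proof eventually_elim
    case (elim k)
    \<comment> \<open>The series also counts index 0; its terms being nonnegative, it still
      dominates.\<close>
    have "(\<Sum>i=1..k. (\<alpha> i)\<^sup>2) \<le> (\<Sum>i. (\<alpha> i)\<^sup>2)"
      by (intro sum_le_suminf square_summable) auto
    then have "((dist (x 1) s)\<^sup>2 + L\<^sup>2 * (\<Sum>i=1..k. (\<alpha> i)\<^sup>2)) / (2 * (\<Sum>i=1..k. \<alpha> i))
        \<le> ?C / (2 * (\<Sum>i=1..k. \<alpha> i))"
      using elim by (intro divide_right_mono add_left_mono mult_left_mono) auto
    then show ?case
      using best_value_bound[OF assms elim(2,1)] best_value_ge[OF assms elim(2)] by simp
  qed
  then show ?thesis
    by (rule LIM_zero_cancel[OF Lim_null_comparison[OF _ lim]])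
qed

text \<open>If the gap stayed at least \<open>e\<close> from some index on, the bounded weighted gap
  sums would bound the step sums, against their divergence.\<close>

lemma frequently_near_optimal:
  assumes s: "s \<in> solutions f \<Omega>" and e: "0 < e"
  shows "\<exists>k\<ge>n. 1 \<le> k \<and> f (x k) - f s < e"
proof (rule ccontr)
  assume *: "\<not> ?thesis"
  \<comment> \<open>The scheme is only specified from index 1 on.\<close>
  define N where "N = max n 1"
  have far: "e \<le> f (x k) - f s" if "N \<le> k" for k
    using * that by (force simp: N_def)
  define C where "C = (dist (x N) s)\<^sup>2 + L\<^sup>2 * (\<Sum>i. (\<alpha> i)\<^sup>2)"
  have bound: "(\<Sum>i=1..k. \<alpha> i) \<le> (\<Sum>i=1..<N. \<alpha> i) + C / (2 * e)" if "N \<le> k" for k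
  proof -
    have "2 * ((\<Sum>i=N..<Suc k. \<alpha> i) * e) = 2 * (\<Sum>i=N..<Suc k. \<alpha> i * e)"
      by (simp only: sum_distrib_right)
    also have "\<dots> \<le> 2 * (\<Sum>i=N..<Suc k. \<alpha> i * (f (x i) - f s))"
      using nonneg far by (intro mult_left_mono sum_mono) (auto simp: N_def)
    also have "\<dots> \<le> (dist (x N) s)\<^sup>2 + L\<^sup>2 * (\<Sum>i=N..<Suc k. (\<alpha> i)\<^sup>2)"
      using s that by (intro weighted_gap_sum_le) (auto simp: N_def solutions_def)
    also have "\<dots> \<le> C"
      unfolding C_def
      by (intro add_left_mono mult_left_mono sum_le_suminf square_summable) auto
    finally have "(\<Sum>i=N..<Suc k. \<alpha> i) \<le> C / (2 * e)"
      using e by (simp add: pos_le_divide_eq algebra_simps)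
    moreover have "(\<Sum>i=1..k. \<alpha> i) = (\<Sum>i=1..<N. \<alpha> i) + (\<Sum>i=N..<Suc k. \<alpha> i)"
      using that by (subst sum.atLeastLessThan_concat)
        (auto simp: N_def atLeastLessThanSuc_atLeastAtMost)
    ultimately show ?thesis
      by simp
  qed
  have "\<forall>\<^sub>F k in sequentially. (\<Sum>i=1..<N. \<alpha> i) + C / (2 * e) < (\<Sum>i=1..k. \<alpha> i)"
    using diverges by (simp add: filterlim_at_top_dense)
  then have "\<forall>\<^sub>F k in sequentially. False"
    using eventually_ge_at_top[of N] by eventually_elim (use bound in force)
  then show False
    by simp
qed

text \<open>Gaps relative to a solution are nonnegative, so after index \<open>n\<close> the squared
  distance to \<open>z\<close> grows by at most a tail of a convergent series. One sufficiently late
  close visit therefore traps all later iterates.\<close>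

lemma cluster_point_imp_limit:
  assumes z: "z \<in> solutions f \<Omega>" and near: "\<And>e n. 0 < e \<Longrightarrow> \<exists>k\<ge>n. dist (x k) z < e"
  shows "x \<longlonglongrightarrow> z"
proof (rule metric_LIMSEQ_I)
  fix e :: real assume e: "0 < e"
  \<comment> \<open>Half of the squared radius is for the close visit, half for the tail.\<close>
  define c where "c = e\<^sup>2 / 2"
  have c: "0 < c"
    using e by (simp add: c_def)
  have "summable (\<lambda>i. L\<^sup>2 * (\<alpha> i)\<^sup>2)"
    using square_summable by (rule summable_mult)
  then obtain N where N: "\<And>n k. N \<le> n \<Longrightarrow> norm (\<Sum>i=n..<k. L\<^sup>2 * (\<alpha> i)\<^sup>2) < c"
    using c unfolding summable_Cauchy by blast
  obtain n where n: "max N 1 \<le> n" "dist (x n) z < sqrt c"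
    using near[of "sqrt c" "max N 1"] c by auto
  have "(dist (x n) z)\<^sup>2 < (sqrt c)\<^sup>2"
    using n(2) by (intro power_strict_mono) auto
  then have dn: "(dist (x n) z)\<^sup>2 < c"
    using c by simp
  have "dist (x k) z < e" if k: "n \<le> k" for k
  proof -
    have "0 \<le> (\<Sum>i=n..<k. \<alpha> i * (f (x i) - f z))"
      using nonneg z n(1) iterate_mem
      by (intro sum_nonneg mult_nonneg_nonneg) (auto simp: solutions_def)
    then have "(dist (x k) z)\<^sup>2 \<le> (dist (x n) z)\<^sup>2 + L\<^sup>2 * (\<Sum>i=n..<k. (\<alpha> i)\<^sup>2)"
      using descent_sum[of n k z] n(1) z k by (simp add: solutions_def)
    also have "\<dots> = (dist (x n) z)\<^sup>2 + (\<Sum>i=n..<k. L\<^sup>2 * (\<alpha> i)\<^sup>2)"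
      by (simp only: sum_distrib_left)
    also have "\<dots> < c + c"
      using dn N[of n k] n(1) by (intro add_strict_mono) auto
    finally show ?thesis
      using e by (simp add: c_def power_less_imp_less_base)
  qed
  then show "\<exists>no. \<forall>k\<ge>no. dist (x k) z < e"
    by blast
qed

text \<open>Near-optimal iterates are selected along \<open>\<kappa>\<close> and thinned by
  compactness; continuity makes the limit a solution, and it is a cluster point of the full
  sequence.\<close>

theorem iterates_converge: "\<exists>z\<in>solutions f \<Omega>. x \<longlonglongrightarrow> z"
proof -
  have cont: "continuous_on UNIV f"
    using lipschitz by (rule lipschitz_on_continuous_on)
  obtain s where s: "s \<in> solutions f \<Omega>"
    using solutions_closed_nonempty(2)[OF continuous_on_subset[OF cont] compact nonempty] by blast
  have "\<exists>k\<ge>n. 1 \<le> k \<and> f (x k) - f s < inverse (real (Suc n))" for n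
    by (intro frequently_near_optimal[OF s]) simp
  then obtain \<kappa> where \<kappa>: "\<And>n. n \<le> \<kappa> n" "\<And>n. 1 \<le> \<kappa> n"
      "\<And>n. f (x (\<kappa> n)) - f s < inverse (real (Suc n))"
    by metis
  obtain z r where z: "z \<in> \<Omega>" and r: "strict_mono (r :: nat \<Rightarrow> nat)"
    and lim: "((x \<circ> \<kappa>) \<circ> r) \<longlonglongrightarrow> z"
    using seq_compactE[OF compact_imp_seq_compact[OF compact], of "x \<circ> \<kappa>"] iterate_mem \<kappa>(2)
    by (metis comp_apply)
  have lim_f: "(\<lambda>n. f (((x \<circ> \<kappa>) \<circ> r) n)) \<longlonglongrightarrow> f z"
    by (rule continuous_on_tendsto_compose[OF cont lim]) auto
  have lim_s: "(\<lambda>n. f s + inverse (real (Suc (r n)))) \<longlonglongrightarrow> f s + 0"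
    using LIMSEQ_subseq_LIMSEQ[OF LIMSEQ_inverse_real_of_nat r]
    by (intro tendsto_add tendsto_const) (simp add: o_def)
  have "f (((x \<circ> \<kappa>) \<circ> r) n) \<le> f s + inverse (real (Suc (r n)))" for n
    using \<kappa>(3)[of "r n"] by simp
  then have "f z \<le> f s + 0"
    using LIMSEQ_le[OF lim_f lim_s] by blast
  then have sol: "z \<in> solutions f \<Omega>"
    using s z by (force simp: solutions_def)
  have "\<exists>k\<ge>n. dist (x k) z < e" if e: "0 < e" for e n
  proof -
    obtain N where "\<forall>j\<ge>N. dist (((x \<circ> \<kappa>) \<circ> r) j) z < e"
      using metric_LIMSEQ_D[OF lim e] by blast
    \<comment> \<open>The index \<open>max N n\<close> is both close to the limit and past
      \<open>n\<close>.\<close>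
    then have "dist (x (\<kappa> (r (max N n)))) z < e"
      by simp
    moreover have "n \<le> \<kappa> (r (max N n))"
      using \<kappa>(1)[of "r (max N n)"] seq_suble[OF r, of "max N n"] by linarith
    ultimately show ?thesis
      by blast
  qed
  then show ?thesis
    using cluster_point_imp_limit[OF sol] sol by blast
qed

end

section \<open>Application to the constrained maximal time problem\<close>

theorem theorem5p2:
  fixes F \<Omega> :: "(real ^ 'n) set"
    and \<Omega>s :: "nat \<Rightarrow> (real ^ 'n) set"
    and m :: nat
    and \<alpha> :: "nat \<Rightarrow> real"
    and x xs \<omega> :: "nat \<Rightarrow> real ^ 'n"
  defines "T \<equiv> max_time F \<Omega>s m"
  defines "S \<equiv> solutions T \<Omega>"
  defines "Vopt \<equiv> (INF y\<in>\<Omega>. T y)"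
  defines "V \<equiv> (\<lambda>k. MIN j\<in>{1..k}. T (x j))"
  assumes F: "F \<noteq> {}" "closed F" "convex F" "0 \<in> interior F"
    and m: "m \<ge> 1"
    and \<Omega>s: "\<And>i. i \<in> {1..m} \<Longrightarrow> \<Omega>s i \<noteq> {} \<and> closed (\<Omega>s i) \<and> bounded (\<Omega>s i) \<and> convex (\<Omega>s i)"
    and \<Omega>: "\<Omega> \<noteq> {}" "closed \<Omega>" "bounded \<Omega>" "convex \<Omega>"
    and x1: "x 1 \<in> \<Omega>"
    and step: "\<And>k. k \<ge> 1 \<Longrightarrow> x (Suc k) = closest_point \<Omega> (x k - \<alpha> k *\<^sub>R xs k)"
    and direction: "\<And>k. k \<ge> 1 \<Longrightarrow> \<exists>i\<in>active F \<Omega>s m (x k).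
          if x k \<in> {w - d |w d. w \<in> \<Omega>s i \<and> d \<in> asymptotic_cone F}
          then xs k \<in> {0}
          else \<omega> k \<in> \<Omega>s i \<and>
               xs k \<in> uminus ` subdifferential (minkowski_fun F) (\<omega> k - x k)
                      \<inter> normal_cone (\<Omega>s i) (\<omega> k)"
    and \<alpha>_nonneg: "\<And>k. k \<ge> 1 \<Longrightarrow> \<alpha> k \<ge> 0"
    and \<alpha>_sum: "filterlim (\<lambda>k. \<Sum>i=1..k. \<alpha> i) at_top sequentially"
    and \<alpha>_sq_sum: "summable (\<lambda>i. (\<alpha> (Suc i))\<^sup>2)"
  shows "(\<exists>z\<in>S. x \<longlonglongrightarrow> z) \<and> V \<longlonglongrightarrow> Vopt \<and>
         (\<exists>L. L-lipschitz_on UNIV T) \<and>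
         (\<forall>L k. L-lipschitz_on UNIV T \<longrightarrow> k \<ge> 1 \<longrightarrow> (\<Sum>i=1..k. \<alpha> i) > 0 \<longrightarrow>
           V k - Vopt \<le> ((infdist (x 1) S)\<^sup>2 + L\<^sup>2 * (\<Sum>i=1..k. (\<alpha> i)\<^sup>2)) / (2 * (\<Sum>i=1..k. \<alpha> i)))"
proof -
  have subgrad: "xs k \<in> subdifferential T (x k)" if k: "1 \<le> k" for k
  proof -
    obtain i where i: "i \<in> active F \<Omega>s m (x k)" and dir:
        "if x k \<in> {w - d |w d. w \<in> \<Omega>s i \<and> d \<in> asymptotic_cone F}
         then xs k \<in> {0}
         else \<omega> k \<in> \<Omega>s i \<and>
              xs k \<in> uminus ` subdifferential (minkowski_fun F) (\<omega> k - x k)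
                     \<inter> normal_cone (\<Omega>s i) (\<omega> k)"
      using direction[OF k] by blast
    have ne: "\<Omega>s i \<noteq> {}"
      using i \<Omega>s by (auto simp: active_def)
    have "xs k \<in> subdifferential (min_time F (\<Omega>s i)) (x k)"
    proof (cases "x k \<in> {w - d |w d. w \<in> \<Omega>s i \<and> d \<in> asymptotic_cone F}")
      case True
      then have "min_time F (\<Omega>s i) (x k) = 0" "xs k = 0"
        using min_time_eq_0[OF F(4)] dir[unfolded if_P[OF True]] by auto
      \<comment> \<open>The time function is nonnegative and vanishes at \<open>x k\<close>, so 0 is
        a subgradient there.\<close>
      then show ?thesis
        using min_time_nonneg[OF F(4) ne] by (simp add: subdifferential_def)
    next
      case False
      then show ?thesis
        using dir[unfolded if_not_P[OF False]] by (intro min_time_subgradient[OF F(4), of "\<omega> k"]) auto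
    qed
    then show ?thesis
      unfolding T_def by (rule max_time_subgradient[OF i])
  qed
  obtain r where "0 < r" "cball 0 r \<subseteq> F"
    using F(4) mem_interior_cball by blast
  then have lip: "(1 / r)-lipschitz_on UNIV T"
    unfolding T_def using \<Omega>s m F(3) by (intro max_time_lipschitz min_time_lipschitz) auto
  have compact: "compact \<Omega>"
    using \<Omega>(2,3) compact_eq_bounded_closed by blast
  \<comment> \<open>This stays generic in \<open>L\<close>: convergence uses the constant
    \<open>1 / r\<close>, the final estimate any given one.\<close>
  have scheme: "projected_subgradient T \<Omega> L \<alpha> x xs" if "L-lipschitz_on UNIV T" for L
    by (rule projected_subgradient.intro; fact compact \<Omega>(4) that x1 step subgrad \<alpha>_nonneg)
  interpret convergent_projected_subgradient T \<Omega> "1 / r" \<alpha> x xs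
    \<comment> \<open>The hypothesis sums squares from index 1, the locale from index 0; one term
      does not affect summability.\<close>
    using \<alpha>_sum \<alpha>_sq_sum[THEN summable_Suc_iff[of "\<lambda>i. (\<alpha> i)\<^sup>2", THEN iffD1]]
    by (rule convergent_projected_subgradient.intro[OF scheme[OF lip]
          convergent_projected_subgradient_axioms.intro])
  have S: "closed S" "S \<noteq> {}"
    unfolding S_def
    using solutions_closed_nonempty[OF lipschitz_on_continuous_on[OF lipschitz_on_subset[OF lip]]]
      compact \<Omega>(1) by auto
  \<comment> \<open>The distance to the closed set \<open>S\<close> is attained, and the nearest
    solution serves as comparison point in the estimate.\<close>
  obtain s where s: "s \<in> S" "infdist (x 1) S = dist (x 1) s"
    using infdist_attains_inf[OF S] by blast
  have Ts: "T s = Vopt"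
    using s(1) unfolding S_def Vopt_def by (rule solutions_eq_INF)
  have "V k - Vopt \<le> ((infdist (x 1) S)\<^sup>2 + L\<^sup>2 * (\<Sum>i=1..k. (\<alpha> i)\<^sup>2)) / (2 * (\<Sum>i=1..k. \<alpha> i))"
    if "L-lipschitz_on UNIV T" "1 \<le> k" "0 < (\<Sum>i=1..k. \<alpha> i)" for L k
    using projected_subgradient.best_value_bound[OF scheme[OF that(1)] s(1)[unfolded S_def] that(2,3)]
    unfolding s(2) Ts V_def .
  moreover have "V \<longlonglongrightarrow> Vopt"
    using best_value_tendsto[OF s(1)[unfolded S_def]] unfolding Ts V_def .
  ultimately show ?thesis
    using iterates_converge lip unfolding S_def by blast
qed

end
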